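(* Let $q$ be a power of a prime, let $n\ge 3$ and $s\ge 1$ be integers with $\gcd(s,n)=1$, and put $\sigma=q^s$. Let $b\in\mathbb F_{q^n}^*$. The polynomial $f(x)=x^\sigma+bx^{\sigma^2}\in\mathbb F_{q^n}[x]$ is scattered if and only if there is no $x\in\mathbb F_{q^n}^*$ such that $$\sum_{i=0}^{n-1}w^{(\sigma^i-1)/(\sigma-1)}=0,\quad\text{where } w=-(1+b^{-1}x^{\sigma-\sigma^2}).$$
   Context: $\mathbb F_{q^n}$ is the finite field with $q^n$ elements and $\mathbb F_{q^n}^*=\mathbb F_{q^n}\setminus\{0\}$. A linearized polynomial $f$ over $\mathbb F_{q^n}$ (an $\mathbb F_q$-linear map $\mathbb F_{q^n}\to\mathbb F_{q^n}$) is called scattered if for any $t,x\in\mathbb F_{q^n}$ the condition $xf(t)-tf(x)=0$ holds if and only if $x$ and $t$ are $\mathbb F_q$-linearly dependent. The term with $i=0$ in the sum is $w^0=1$ (also when $w=0$). *)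

theory Defs
  imports
    "HOL-Computational_Algebra.Computational_Algebra"
    "HOL-Library.Cardinality"
    "HOL-Number_Theory.Prime_Powers"
begin

text \<open>
  The field with \<open>q^n\<close> elements is a type of class \<open>finite_field\<close> with \<open>CARD('a) = q ^ n\<close>.  The lemmas
  below show that in such a type \<open>Fq q\<close> is the unique subfield with \<open>q\<close> elements.
\<close>

definition Fq :: "nat \<Rightarrow> 'a::field set"
  where "Fq q = {c. c ^ q = c}"

definition lin_dependent :: "'a::field set \<Rightarrow> 'a \<Rightarrow> 'a \<Rightarrow> bool"
  where "lin_dependent K x t \<longleftrightarrow>
    (\<exists>\<alpha>\<in>K. \<exists>\<beta>\<in>K. (\<alpha> \<noteq> 0 \<or> \<beta> \<noteq> 0) \<and> \<alpha> * x + \<beta> * t = 0)"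

text \<open>Exponents are not reduced modulo \<open>x^(q^n) - x\<close>: any power of \<open>q\<close> may occur.\<close>

definition linearized :: "nat \<Rightarrow> 'a::field poly \<Rightarrow> bool"
  where "linearized q f \<longleftrightarrow> (\<forall>k. coeff f k \<noteq> 0 \<longrightarrow> (\<exists>i. k = q ^ i))"

definition scattered :: "nat \<Rightarrow> 'a::field poly \<Rightarrow> bool"
  where "scattered q f \<longleftrightarrow> linearized q f \<and>
    (\<forall>t x. x * poly f t - t * poly f x = 0 \<longleftrightarrow> lin_dependent (Fq q) x t)"

lemma card_pow_eq_self_le:
  fixes m :: nat
  assumes "m \<ge> 2"
  shows "finite {c::'a::field. c ^ m = c}" "card {c::'a. c ^ m = c} \<le> m"
proof -
  define p :: "'a poly" where "p = monom 1 m - monom 1 1"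
  have "coeff p m = 1" using assms by (simp add: p_def)
  then have nz: "p \<noteq> 0" by auto
  have eq: "{c::'a. c ^ m = c} = {c. poly p c = 0}"
    by (auto simp: p_def poly_monom)
  have "degree p \<le> m" unfolding p_def
    using assms by (intro degree_diff_le) (auto intro: order.trans[OF degree_monom_le])
  then show "finite {c::'a. c ^ m = c}" "card {c::'a. c ^ m = c} \<le> m"
    unfolding eq using poly_roots_finite[OF nz] card_poly_roots_bound[OF nz] by auto
qed

lemma card_Fq:
  assumes "q \<ge> 2" "n \<ge> 1" "CARD('a::finite_field) = q ^ n"
  shows "card (Fq q :: 'a set) = q"
proof -
  define Q where "Q = q ^ n"
  have qQ: "q \<le> Q"
    unfolding Q_def using assms(1,2) by (metis One_nat_def le_trans one_le_numeral power_increasing power_one_right)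
  have "(int q - 1) dvd (int q ^ n - 1)"
    using power_diff_1_eq[of "int q" n] by (metis dvd_triv_left)
  then have "int (q - 1) dvd int (Q - 1)"
    using assms(1) qQ by (simp add: of_nat_diff Q_def)
  then have "(q - 1) dvd (Q - 1)" by (simp only: int_dvd_int_iff)
  then obtain r where r: "Q - 1 = (q - 1) * r" by (auto elim: dvdE)
  have rpos: "r \<ge> 1" using r qQ assms(1) by (cases r) auto
  define g :: "'a poly" where "g = (\<Sum>i<r. monom 1 ((q - 1) * i))"
  have polyg: "(c ^ (q - 1) - 1) * poly g c = c ^ (Q - 1) - 1" for c :: 'a
    unfolding g_def r using power_diff_1_eq[of "c ^ (q - 1)" r]
    by (simp add: poly_sum poly_monom power_mult)
  have "coeff g 0 = (\<Sum>i<r. if i = 0 then 1 else 0)"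
    unfolding g_def using assms(1) by (auto simp: coeff_sum intro!: sum.cong)
  then have "coeff g 0 = 1" using rpos by (simp add: sum.delta)
  then have gnz: "g \<noteq> 0" by auto
  have "degree g \<le> (q - 1) * (r - 1)"
    unfolding g_def by (intro degree_sum_le) (auto intro!: order.trans[OF degree_monom_le] mult_le_mono2)
  then have degg: "degree g \<le> Q - q"
    using r assms(1) qQ by (simp add: algebra_simps)
  have "(UNIV :: 'a set) \<subseteq> Fq q \<union> {c. poly g c = 0}"
  proof
    fix c :: 'a
    show "c \<in> Fq q \<union> {c. poly g c = 0}"
    proof (cases "c = 0")
      case True
      then show ?thesis using assms(1) by (simp add: Fq_def)
    next
      case False
      have "c ^ Q = c"
        using finite_field_power_card_eq_same[of c] assms(3) by (simp add: Q_def)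
      moreover have "c ^ Q = c * c ^ (Q - 1)"
        using qQ assms(1) by (simp add: power_eq_if)
      ultimately have "c ^ (Q - 1) = 1" using False by auto
      with polyg[of c] have "c ^ (q - 1) = 1 \<or> poly g c = 0" by auto
      moreover have "c ^ q = c * c ^ (q - 1)" using assms(1) by (simp add: power_eq_if)
      ultimately show ?thesis by (auto simp: Fq_def)
    qed
  qed
  then have "card (UNIV :: 'a set) \<le> card (Fq q \<union> {c::'a. poly g c = 0})"
    by (intro card_mono) auto
  also have "\<dots> \<le> card (Fq q :: 'a set) + card {c::'a. poly g c = 0}"
    by (rule card_Un_le)
  also have "\<dots> \<le> card (Fq q :: 'a set) + (Q - q)"
    using card_poly_roots_bound[OF gnz] degg by linarith
  finally have "q \<le> card (Fq q :: 'a set)"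
    using assms(3) qQ by (simp add: Q_def)
  moreover have "card (Fq q :: 'a set) \<le> q"
    using card_pow_eq_self_le(2)[OF assms(1)] by (simp add: Fq_def)
  ultimately show ?thesis by simp
qed

lemma of_nat_CARD_eq_0: "of_nat CARD('a::finite_field) = (0::'a)"
proof -
  have "(\<Sum>x\<in>UNIV. x + (1::'a)) = (\<Sum>x\<in>UNIV. x)"
    by (rule sum.reindex_bij_witness[of _ "\<lambda>x. x - 1" "\<lambda>x. x + 1"]) auto
  then show ?thesis by (simp add: sum.distrib)
qed

lemma Fq_subfield:
  assumes "primepow q" "n \<ge> 1" "CARD('a::finite_field) = q ^ n"
  shows "(0::'a) \<in> Fq q" "(1::'a) \<in> Fq q"
    "\<And>x y::'a. x \<in> Fq q \<Longrightarrow> y \<in> Fq q \<Longrightarrow> x + y \<in> Fq q"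
    "\<And>x y::'a. x \<in> Fq q \<Longrightarrow> y \<in> Fq q \<Longrightarrow> x * y \<in> Fq q"
    "\<And>x::'a. x \<in> Fq q \<Longrightarrow> - x \<in> Fq q"
    "\<And>x::'a. x \<in> Fq q \<Longrightarrow> inverse x \<in> Fq q"
proof -
  obtain p k where pk: "prime p" "k > 0" "q = p ^ k"
    using assms(1) by (auto simp: primepow_def)
  have "CHAR('a) dvd p ^ (k * n)"
    using of_nat_CARD_eq_0[where 'a = 'a] assms(3) pk(3)
    by (simp only: of_nat_eq_0_iff_char_dvd power_mult)
  moreover have pc: "prime CHAR('a)" by (simp add: prime_CHAR_semidom)
  ultimately have "CHAR('a) = p"
    using pk(1) by (meson prime_dvd_power primes_dvd_imp_eq)
  then have q: "q = CHAR('a) ^ k" using pk by simp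
  have qpos: "q > 0" using pk by (simp add: prime_gt_0_nat)
  show "(0::'a) \<in> Fq q" "(1::'a) \<in> Fq q" using qpos by (auto simp: Fq_def)
  show add: "x + y \<in> Fq q" if "x \<in> Fq q" "y \<in> Fq q" for x y :: 'a
    using that freshmans_dream'[OF pc q, of x y] by (simp add: Fq_def)
  show mult: "x * y \<in> Fq q" if "x \<in> Fq q" "y \<in> Fq q" for x y :: 'a
    using that by (simp add: Fq_def power_mult_distrib)
  show "- x \<in> Fq q" if "x \<in> Fq q" for x :: 'a
  proof -
    have "0 = (x + - x) ^ q" using qpos by simp
    also have "\<dots> = x ^ q + (- x) ^ q" by (rule freshmans_dream'[OF pc q])
    finally show ?thesis using that by (simp add: Fq_def eq_neg_iff_add_eq_0 add.commute)
  qed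
  show "inverse x \<in> Fq q" if "x \<in> Fq q" for x :: 'a
    using that by (simp add: Fq_def power_inverse)
qed

lemma Fq_unique:
  fixes K :: "'a::finite_field set"
  assumes "q \<ge> 2" "n \<ge> 1" "CARD('a) = q ^ n"
    and "card K = q" "0 \<in> K" "\<And>x y. x \<in> K \<Longrightarrow> y \<in> K \<Longrightarrow> x * y \<in> K"
  shows "K = Fq q"
proof -
  have sub: "K \<subseteq> Fq q"
  proof
    fix c assume c: "c \<in> K"
    show "c \<in> Fq q"
    proof (cases "c = 0")
      case True
      then show ?thesis using assms(1) by (simp add: Fq_def)
    next
      case False
      have fin: "finite K" by simp
      have inj: "inj_on ((*) c) (K - {0})" using False by (auto simp: inj_on_def)
      have "(*) c ` (K - {0}) \<subseteq> K - {0}" using assms(6) c False by auto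
      then have im: "(*) c ` (K - {0}) = K - {0}"
        using inj fin by (intro card_subset_eq) (auto simp: card_image)
      have "\<Prod>(K - {0}) = (\<Prod>x\<in>K - {0}. c * x)"
        by (subst im[symmetric], subst prod.reindex[OF inj]) simp
      also have "\<dots> = c ^ (q - 1) * \<Prod>(K - {0})"
        using assms(4,5) by (simp add: prod.distrib card_Diff_singleton)
      finally have "c ^ (q - 1) = 1" by simp
      moreover have "c ^ q = c * c ^ (q - 1)" using assms(1) by (simp add: power_eq_if)
      ultimately show ?thesis by (simp add: Fq_def)
    qed
  qed
  then show ?thesis
    using card_Fq[OF assms(1-3)] assms(4) by (intro card_subset_eq) auto
qed

end

theory Submission
  imports Defs "HOL-Number_Theory.Cong"
begin

text \<open>
  Write \<open>\<sigma> = q ^ s\<close> and \<open>f x = x ^ \<sigma> + b * x ^ (\<sigma>\<^sup>2)\<close>. For \<open>x \<noteq> 0\<close> put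
  \<open>t = l * x\<close> and \<open>m = l ^ \<sigma> - l\<close>. Since \<open>l ^ (\<sigma>\<^sup>2) - l = m ^ \<sigma> + m\<close>, the expression
  \<open>x * f t - t * f x\<close> is a nonzero multiple of \<open>m ^ \<sigma> - w * m\<close>, where \<open>w\<close> is the element
  attached to \<open>x\<close> in the theorem (\<open>cross_difference_binomial\<close>). As \<open>s\<close> is coprime to \<open>n\<close>, the map
  \<open>x \<mapsto> x ^ \<sigma>\<close> generates the Galois group of the field over its subfield with \<open>q\<close> elements, so
  \<open>x\<close> and \<open>t\<close> are dependent exactly when \<open>m = 0\<close>. Thus \<open>f\<close> fails to be scattered iff for some
  \<open>x \<noteq> 0\<close> the equation \<open>m ^ \<sigma> = w * m\<close> has a nonzero solution of the form \<open>m = l ^ \<sigma> - l\<close>.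

  By the additive form of Hilbert's Theorem 90, \<open>m\<close> has that form iff its trace
  \<open>\<Sum>i<n. m ^ (\<sigma> ^ i)\<close> vanishes, and for a solution \<open>m\<close> of \<open>m ^ \<sigma> = w * m\<close> this trace
  is \<open>m\<close> times the sum \<open>S\<close> of the powers of \<open>w\<close> in the theorem. Conversely \<open>S = 0\<close> already
  implies that \<open>w\<close> has norm \<open>1\<close>, because \<open>w * S ^ \<sigma>\<close> is \<open>S - 1\<close> plus the norm of \<open>w\<close>; the
  multiplicative form of Hilbert's Theorem 90 then provides a nonzero solution \<open>m\<close>. So such an
  \<open>m\<close> exists iff \<open>S = 0\<close> (\<open>twisted_fixed_coboundary_iff\<close>).

  Both forms of Hilbert's Theorem 90 are proved by counting. The elements \<open>l ^ \<sigma> - l\<close> (the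
  additive coboundaries) and \<open>m ^ (\<sigma> - 1)\<close> with \<open>m \<noteq> 0\<close> (the multiplicative ones) are values of
  group homomorphisms with known kernels, which tells how many there are. They are roots of the
  polynomials that express trace \<open>0\<close> and norm \<open>1\<close>, and their number is the degree of these
  polynomials, so they are all the roots.
\<close>

section \<open>Preliminaries on counting and geometric exponents\<close>

lemma card_eq_card_fibre_mult_card_image:
  assumes "finite A" and "\<And>a. a \<in> A \<Longrightarrow> card {x \<in> A. f x = f a} = k"
  shows "card A = k * card (f ` A)"
proof -
  have "card A = (\<Sum>y\<in>f ` A. \<Sum>x | x \<in> A \<and> f x = y. 1)"
    using sum.image_gen[OF assms(1), of "\<lambda>_. 1::nat" f] by simp
  also have "\<dots> = (\<Sum>y\<in>f ` A. k)"
    by (rule sum.cong) (use assms(2) in auto)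
  finally show ?thesis by simp
qed

lemma subset_poly_roots_eq:
  fixes p :: "'a::field poly"
  assumes "p \<noteq> 0" "degree p \<le> card A" "\<And>a. a \<in> A \<Longrightarrow> poly p a = 0"
  shows "A = {a. poly p a = 0}"
proof (rule card_seteq)
  show "finite {a. poly p a = 0}" using assms(1) by (rule poly_roots_finite)
  show "A \<subseteq> {a. poly p a = 0}" using assms(3) by auto
  show "card {a. poly p a = 0} \<le> card A"
    using card_poly_roots_bound[OF assms(1)] assms(2) by linarith
qed

lemma geometric_sum_nat:
  fixes a :: nat
  assumes "a \<ge> 1"
  shows "(a - 1) * (\<Sum>j<i. a ^ j) = a ^ i - 1"
proof -
  have "int ((a - 1) * (\<Sum>j<i. a ^ j)) = int (a ^ i - 1)"
    using power_diff_1_eq[of "int a" i] assms by (simp add: of_nat_diff)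
  then show ?thesis by (simp only: of_nat_eq_iff)
qed

lemma geometric_quotient_eq_sum:
  fixes a :: nat
  assumes "a \<ge> 2"
  shows "(a ^ i - 1) div (a - 1) = (\<Sum>j<i. a ^ j)"
proof -
  have "a - 1 > 0" using assms by simp
  moreover have "a ^ i - 1 = (a - 1) * (\<Sum>j<i. a ^ j)" using geometric_sum_nat[of a i] assms by simp
  ultimately show ?thesis by (metis nonzero_mult_div_cancel_left not_gr_zero)
qed

section \<open>A Frobenius power generating the Galois group\<close>

locale frobenius_generator =
  fixes q n s :: nat and K :: "'a::finite_field itself"
  assumes primepow_q: "primepow q" and n_pos: "n \<ge> 1" and s_pos: "s \<ge> 1"
    and coprime_s_n: "coprime s n" and card_field: "CARD('a) = q ^ n"
begin

lemma q_ge_2: "q \<ge> 2"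
  using primepow_gt_Suc_0[OF primepow_q] by simp

lemma q_power_ge_2: "q ^ s \<ge> 2"
  using q_ge_2 s_pos by (metis le_trans one_le_numeral power_increasing power_one_right)

lemma q_eq_CHAR_power: "\<exists>k. q = CHAR('a) ^ k"
proof -
  obtain p k where pk: "prime p" "k > 0" "q = p ^ k"
    using primepow_q by (auto simp: primepow_def)
  have "CHAR('a) dvd p ^ (k * n)"
    using of_nat_CARD_eq_0[where 'a = 'a] card_field pk(3)
    by (simp only: of_nat_eq_0_iff_char_dvd power_mult)
  moreover have "prime CHAR('a)" by (simp add: prime_CHAR_semidom)
  ultimately have "CHAR('a) = p"
    using pk(1) by (meson prime_dvd_power primes_dvd_imp_eq)
  then show ?thesis using pk by auto
qed

lemma add_power: "(x + y) ^ (q ^ i) = x ^ (q ^ i) + (y::'a) ^ (q ^ i)"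
proof -
  obtain k where "q = CHAR('a) ^ k" using q_eq_CHAR_power by auto
  then have "q ^ i = CHAR('a) ^ (k * i)" by (simp add: power_mult)
  moreover have "prime CHAR('a)" by (simp add: prime_CHAR_semidom)
  ultimately show ?thesis using freshmans_dream' by blast
qed

lemma diff_power: "(x - y) ^ (q ^ i) = x ^ (q ^ i) - (y::'a) ^ (q ^ i)"
  using add_power[of "x - y" y i] by simp

lemma sum_power: "(\<Sum>j\<in>A. g j :: 'a) ^ (q ^ i) = (\<Sum>j\<in>A. g j ^ (q ^ i))"
  using q_ge_2 by (induction A rule: infinite_finite_induct) (auto simp: add_power)

lemma power_q_cong:
  assumes "[i = j] (mod n)"
  shows "(x::'a) ^ (q ^ i) = x ^ (q ^ j)"
proof -
  have period: "x ^ (q ^ (n * k)) = x" for k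
  proof (induction k)
    case (Suc k)
    have "x ^ (q ^ (n * Suc k)) = (x ^ (q ^ n)) ^ (q ^ (n * k))"
      by (simp add: power_add power_mult)
    also have "x ^ (q ^ n) = x"
      using finite_field_power_card_eq_same[of x] card_field by simp
    finally show ?case using Suc by simp
  qed simp
  have "x ^ (q ^ i) = x ^ (q ^ (i mod n))" for i
  proof -
    have "x ^ (q ^ i) = x ^ (q ^ (n * (i div n) + i mod n))" by simp
    also have "\<dots> = (x ^ (q ^ (n * (i div n)))) ^ (q ^ (i mod n))"
      by (simp only: power_add power_mult)
    finally show ?thesis using period by simp
  qed
  then show ?thesis using assms by (metis cong_def)
qed

lemma power_sigma_n: "(x::'a) ^ ((q ^ s) ^ n) = x"
  using power_q_cong[of "s * n" 0 x] by (simp add: power_mult cong_def)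

lemma power_sigma_eq_self_iff: "(x::'a) ^ (q ^ s) = x \<longleftrightarrow> x \<in> Fq q"
proof
  assume x: "x ^ (q ^ s) = x"
  \<comment> \<open>The \<open>r\<close>-fold iterate of \<open>x \<mapsto> x ^ \<sigma>\<close> is \<open>x \<mapsto> x ^ q\<close>.\<close>
  obtain r where r: "[s * r = Suc 0] (mod n)"
    using cong_solve_coprime_nat[OF coprime_s_n] by auto
  have "x ^ (q ^ (s * k)) = x" for k
    by (induction k) (use x in \<open>auto simp: power_add power_mult\<close>)
  then show "x \<in> Fq q" using power_q_cong[OF r, of x] by (simp add: Fq_def)
next
  assume "x \<in> Fq q"
  then have "x ^ q = x" by (simp add: Fq_def)
  then have "x ^ (q ^ k) = x" for k
    by (induction k) (auto simp: power_mult)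
  then show "x ^ (q ^ s) = x" .
qed

lemma bij_betw_mult_mod: "bij_betw (\<lambda>i. s * i mod n) {..<n} {..<n}"
proof -
  have "inj_on (\<lambda>i. s * i mod n) {..<n}"
  proof (rule inj_onI)
    fix i j assume ij: "i \<in> {..<n}" "j \<in> {..<n}" and eq: "s * i mod n = s * j mod n"
    have "[s * i = s * j] (mod n)" using eq by (simp add: cong_def)
    then have "[i = j] (mod n)" using coprime_s_n by (simp add: cong_mult_lcancel_nat)
    then show "i = j" using ij by (simp add: cong_def)
  qed
  moreover have "(\<lambda>i. s * i mod n) ` {..<n} \<subseteq> {..<n}" using n_pos by auto
  ultimately show ?thesis
    by (simp add: bij_betw_def endo_inj_surj)
qed

lemma power_sigma_eq: "(x::'a) ^ ((q ^ s) ^ i) = x ^ (q ^ (s * i mod n))"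
  using power_q_cong[of "s * i" "s * i mod n" x] by (simp add: power_mult)

text \<open>
  Trace and norm may be computed with any generator of the Galois group. This matters because only
  the expressions in the powers of \<open>q\<close> have a degree small enough for the counting arguments below.
\<close>

lemma trace_sigma_eq: "(\<Sum>i<n. (x::'a) ^ ((q ^ s) ^ i)) = (\<Sum>j<n. x ^ (q ^ j))"
  unfolding power_sigma_eq by (rule sum.reindex_bij_betw[OF bij_betw_mult_mod])

lemma norm_sigma_eq: "(x::'a) ^ (\<Sum>i<n. (q ^ s) ^ i) = x ^ (\<Sum>j<n. q ^ j)"
  unfolding power_sum power_sigma_eq by (rule prod.reindex_bij_betw[OF bij_betw_mult_mod])

section \<open>Hilbert's Theorem 90 by counting\<close>

lemma trace_coboundary: "(\<Sum>i<n. ((l::'a) ^ (q ^ s) - l) ^ ((q ^ s) ^ i)) = 0"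
proof -
  have "(l ^ (q ^ s) - l) ^ ((q ^ s) ^ i) = l ^ ((q ^ s) ^ Suc i) - l ^ ((q ^ s) ^ i)" for i
    using diff_power[of "l ^ (q ^ s)" l "s * i"] by (simp add: power_mult)
  then have "(\<Sum>i<n. (l ^ (q ^ s) - l) ^ ((q ^ s) ^ i)) = l ^ ((q ^ s) ^ n) - l ^ ((q ^ s) ^ 0)"
    using sum_lessThan_telescope[of "\<lambda>i. l ^ ((q ^ s) ^ i)" n] by simp
  then show ?thesis by (simp add: power_sigma_n)
qed

text \<open>
  The additive map \<open>l \<mapsto> l ^ \<sigma> - l\<close> has kernel \<open>Fq q\<close>, so its image has \<open>q ^ (n - 1)\<close> elements.
  The image lies in the zero set of the trace, which has at most \<open>q ^ (n - 1)\<close> elements because the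
  trace is a polynomial of that degree.
\<close>

lemma hilbert90_additive:
  assumes "(\<Sum>i<n. (m::'a) ^ ((q ^ s) ^ i)) = 0"
  shows "\<exists>l. m = l ^ (q ^ s) - l"
proof -
  define f :: "'a \<Rightarrow> 'a" where "f l = l ^ (q ^ s) - l" for l
  define p :: "'a poly" where "p = (\<Sum>j<n. monom 1 (q ^ j))"
  have poly_p: "poly p x = (\<Sum>i<n. x ^ ((q ^ s) ^ i))" for x
    unfolding p_def by (simp add: poly_sum poly_monom trace_sigma_eq)
  have "coeff p 1 = (\<Sum>j<n. if j = 0 then 1 else 0)"
    unfolding p_def coeff_sum using q_ge_2 by (intro sum.cong) (auto simp: power_eq_1_iff)
  then have p: "p \<noteq> 0" using n_pos by auto
  have deg: "degree p \<le> q ^ (n - 1)"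
    unfolding p_def using q_ge_2
    by (intro degree_sum_le) (auto intro!: order.trans[OF degree_monom_le] power_increasing)
  have fibre: "card {x \<in> UNIV. f x = f a} = q" for a
  proof -
    have "f x = f a \<longleftrightarrow> x - a \<in> Fq q" for x
      unfolding power_sigma_eq_self_iff[symmetric] diff_power f_def by (auto simp: algebra_simps)
    moreover have "x - a \<in> Fq q \<longleftrightarrow> x \<in> (\<lambda>c. c + a) ` Fq q" for x
      by (auto intro: image_eqI[where x = "x - a"])
    ultimately have "{x \<in> UNIV. f x = f a} = (\<lambda>c. c + a) ` Fq q" by auto
    then have "card {x \<in> UNIV. f x = f a} = card (Fq q :: 'a set)"
      by (simp add: card_image inj_on_def)
    then show ?thesis using card_Fq[OF q_ge_2 n_pos card_field] by simp
  qed
  have "q ^ n = q * card (range f)"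
    using card_eq_card_fibre_mult_card_image[of UNIV f q] fibre card_field by simp
  moreover have "q ^ n = q * q ^ (n - 1)"
    using n_pos by (simp add: power_eq_if)
  ultimately have card: "card (range f) = q ^ (n - 1)"
    using q_ge_2 by simp
  have "range f = {a. poly p a = 0}"
    by (rule subset_poly_roots_eq[OF p]) (use deg card in \<open>auto simp: poly_p f_def trace_coboundary\<close>)
  then have "m \<in> range f" using assms by (simp add: poly_p)
  then show ?thesis by (auto simp: f_def)
qed

text \<open>
  The same count in the multiplicative group: \<open>m \<mapsto> m ^ (\<sigma> - 1)\<close> has kernel of order
  \<open>q - 1\<close>, and an element of norm \<open>1\<close> is a root of a polynomial whose degree is
  \<open>(q ^ n - 1) / (q - 1)\<close>.
\<close>

lemma hilbert90_multiplicative: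
  assumes "(w::'a) ^ (\<Sum>i<n. (q ^ s) ^ i) = 1"
  shows "\<exists>m. m \<noteq> 0 \<and> w = m ^ (q ^ s - 1)"
proof -
  define f :: "'a \<Rightarrow> 'a" where "f m = m ^ (q ^ s - 1)" for m
  define d where "d = (\<Sum>j<n. q ^ j)"
  define p :: "'a poly" where "p = monom 1 d - 1"
  have qd: "(q - 1) * d = q ^ n - 1"
    unfolding d_def using geometric_sum_nat q_ge_2 by simp
  have "q ^ n > 1" using q_ge_2 n_pos by (intro one_less_power) auto
  then have d: "d > 0" using qd by (cases d) auto
  have "coeff p d = 1" using d by (simp add: p_def)
  then have p: "p \<noteq> 0" by auto
  have deg: "degree p \<le> d"
    unfolding p_def by (intro degree_diff_le) (auto intro: degree_monom_le)
  have fibre: "card {x \<in> UNIV - {0}. f x = f a} = q - 1" if "a \<in> UNIV - {0}" for a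
  proof -
    have pow: "x ^ (q ^ s) = x * f x" for x
      using power_minus_mult[of "q ^ s" x] q_ge_2 by (simp add: f_def mult.commute)
    have "f x = f a \<longleftrightarrow> x / a \<in> Fq q" if "x \<noteq> 0" for x
      unfolding power_sigma_eq_self_iff[symmetric] power_divide pow
      using that \<open>a \<in> UNIV - {0}\<close> by (auto simp: field_simps f_def)
    moreover have "x \<noteq> 0 \<and> x / a \<in> Fq q \<longleftrightarrow> x \<in> (\<lambda>c. c * a) ` (Fq q - {0})" for x
      using that by (auto intro: image_eqI[where x = "x / a"])
    ultimately have "{x \<in> UNIV - {0}. f x = f a} = (\<lambda>c. c * a) ` (Fq q - {0})" by auto
    then have "card {x \<in> UNIV - {0}. f x = f a} = card (Fq q - {0::'a})"
      using that by (simp add: card_image inj_on_def)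
    also have "\<dots> = q - 1"
      using card_Fq[OF q_ge_2 n_pos card_field] Fq_subfield(1)[OF primepow_q n_pos card_field]
      by (simp add: card_Diff_singleton)
    finally show ?thesis .
  qed
  have "q ^ n - 1 = (q - 1) * card (f ` (UNIV - {0}))"
    using card_eq_card_fibre_mult_card_image[of "UNIV - {0}" f "q - 1"] fibre card_field
    by (simp add: card_Diff_singleton)
  then have card: "card (f ` (UNIV - {0})) = d"
    unfolding qd[symmetric] using q_ge_2 by simp
  have "(m ^ (q ^ s - 1)) ^ d = 1" if "m \<noteq> 0" for m :: 'a
  proof -
    have "q ^ s - 1 = (q - 1) * (\<Sum>j<s. q ^ j)" using geometric_sum_nat q_ge_2 by simp
    then have "(m ^ (q ^ s - 1)) ^ d = (m ^ ((q - 1) * d)) ^ (\<Sum>j<s. q ^ j)"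
      by (simp add: power_mult[symmetric] mult_ac)
    moreover have "m * m ^ (q ^ n - 1) = m"
      using finite_field_power_card_eq_same[of m] power_minus_mult[of "q ^ n" m] card_field q_ge_2
      by (simp add: mult.commute)
    ultimately show ?thesis using that qd by simp
  qed
  then have "f ` (UNIV - {0}) = {a. poly p a = 0}"
    by (intro subset_poly_roots_eq[OF p]) (use deg card in \<open>auto simp: p_def f_def poly_monom\<close>)
  moreover have "poly p w = 0"
    using assms by (simp add: p_def d_def poly_monom norm_sigma_eq)
  ultimately show ?thesis by (auto simp: f_def)
qed

section \<open>Twisted fixed points that are coboundaries\<close>

lemma twisted_fixed_power:
  assumes "(m::'a) ^ (q ^ s) = w * m"
  shows "m ^ ((q ^ s) ^ i) = w ^ (\<Sum>j<i. (q ^ s) ^ j) * m"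
proof (induction i)
  case (Suc i)
  have "m ^ ((q ^ s) ^ Suc i) = (m ^ (q ^ s)) ^ ((q ^ s) ^ i)"
    by (simp add: power_mult)
  then show ?case
    by (simp add: assms power_mult_distrib Suc power_add mult_ac)
qed simp

text \<open>
  Raising the sum \<open>S\<close> to the power \<open>\<sigma>\<close> and multiplying by \<open>w\<close> shifts its terms by one place: the
  term \<open>1\<close> is lost and the norm of \<open>w\<close> is gained.
\<close>

lemma norm_eq_1_if_sum_eq_0:
  assumes "(\<Sum>i<n. (w::'a) ^ (\<Sum>j<i. (q ^ s) ^ j)) = 0"
  shows "w ^ (\<Sum>j<n. (q ^ s) ^ j) = 1"
proof -
  define e where "e i = (\<Sum>j<i. (q ^ s) ^ j)" for i
  have e_Suc: "e (Suc i) = 1 + q ^ s * e i" for i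
    unfolding e_def by (simp add: sum.lessThan_Suc_shift sum_distrib_left del: sum.lessThan_Suc)
  have "w * (\<Sum>i<n. w ^ e i) ^ (q ^ s) = (\<Sum>i<n. w ^ e (Suc i))"
    by (simp add: sum_power e_Suc sum_distrib_left power_mult[symmetric] mult_ac)
  also have "\<dots> = (\<Sum>i<Suc n. w ^ e i) - w ^ e 0"
    by (simp add: sum.lessThan_Suc_shift del: sum.lessThan_Suc)
  also have "\<dots> = (\<Sum>i<n. w ^ e i) + w ^ e n - 1"
    by (simp add: e_def)
  finally show ?thesis
    using assms q_ge_2 by (simp add: e_def power_0_left)
qed

lemma twisted_fixed_coboundary_iff:
  fixes w :: 'a
  shows "(\<exists>l. l ^ (q ^ s) - l \<noteq> 0 \<and> (l ^ (q ^ s) - l) ^ (q ^ s) = w * (l ^ (q ^ s) - l))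
    \<longleftrightarrow> (\<Sum>i<n. w ^ (\<Sum>j<i. (q ^ s) ^ j)) = 0" (is "_ \<longleftrightarrow> ?S = 0")
proof -
  have trace: "(\<Sum>i<n. m ^ ((q ^ s) ^ i)) = ?S * m" if "m ^ (q ^ s) = w * m" for m
    using twisted_fixed_power[OF that] by (simp add: sum_distrib_right)
  show ?thesis
  proof (intro iffI; (elim exE conjE)?)
    fix l assume "l ^ (q ^ s) - l \<noteq> 0" "(l ^ (q ^ s) - l) ^ (q ^ s) = w * (l ^ (q ^ s) - l)"
    then show "?S = 0" using trace[of "l ^ (q ^ s) - l"] trace_coboundary[of l] by simp
  next
    assume S: "?S = 0"
    then obtain m where m: "m \<noteq> 0" "w = m ^ (q ^ s - 1)"
      using hilbert90_multiplicative norm_eq_1_if_sum_eq_0 by blast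
    then have fixed: "m ^ (q ^ s) = w * m"
      using power_minus_mult[of "q ^ s" m] q_ge_2 m(2) by simp
    then obtain l where "m = l ^ (q ^ s) - l"
      using trace S hilbert90_additive[of m] by auto
    then show "\<exists>l. l ^ (q ^ s) - l \<noteq> 0 \<and> (l ^ (q ^ s) - l) ^ (q ^ s) = w * (l ^ (q ^ s) - l)"
      using m(1) fixed by blast
  qed
qed

section \<open>The scattered condition for the binomial\<close>

lemma lin_dependent_mult_iff:
  assumes "(x::'a) \<noteq> 0"
  shows "lin_dependent (Fq q) x (l * x) \<longleftrightarrow> l \<in> Fq q"
proof
  note F = Fq_subfield[OF primepow_q n_pos card_field]
  show "lin_dependent (Fq q) x (l * x)" if "l \<in> Fq q"
    unfolding lin_dependent_def
    by (rule bexI[of _ "l"], rule bexI[of _ "-1"]) (use that F(2) F(5)[of 1] in auto)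
  assume "lin_dependent (Fq q) x (l * x)"
  then obtain u v where uv: "u \<in> Fq q" "v \<in> Fq q" "u \<noteq> 0 \<or> v \<noteq> 0" "u * x + v * (l * x) = 0"
    by (auto simp: lin_dependent_def)
  then have "(u + v * l) * x = 0" by (simp add: algebra_simps)
  then have *: "u + v * l = 0" using assms by simp
  with uv(3) have "v \<noteq> 0" by auto
  with * have "l = - u * inverse v" by (simp add: field_simps eq_neg_iff_add_eq_0)
  then show "l \<in> Fq q" using F(4-6) uv(1,2) by auto
qed

text \<open>
  The identity \<open>l ^ (\<sigma>\<^sup>2) - l = m ^ \<sigma> + m\<close> makes the cross difference linear in \<open>m ^ \<sigma>\<close> and \<open>m\<close>;
  \<open>w\<close> is what remains as the coefficient of \<open>- m\<close> after that of \<open>m ^ \<sigma>\<close> is factored out.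
\<close>

lemma cross_difference_binomial:
  fixes b x l :: 'a
  defines "f \<equiv> monom 1 (q ^ s) + monom b ((q ^ s)\<^sup>2)"
    and "w \<equiv> - (1 + inverse b * (x ^ (q ^ s) / x ^ ((q ^ s)\<^sup>2)))"
    and "m \<equiv> l ^ (q ^ s) - l"
  assumes "b \<noteq> 0" "x \<noteq> 0"
  shows "x * poly f (l * x) - l * x * poly f x
    = b * x * x ^ ((q ^ s)\<^sup>2) * (m ^ (q ^ s) - w * m)"
proof -
  have "m ^ (q ^ s) = l ^ ((q ^ s)\<^sup>2) - l ^ (q ^ s)"
    unfolding m_def diff_power by (simp add: power2_eq_square power_mult)
  then have "b * x ^ ((q ^ s)\<^sup>2) * (m ^ (q ^ s) + m) = b * x ^ ((q ^ s)\<^sup>2) * (l ^ ((q ^ s)\<^sup>2) - l)"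
    by (simp add: m_def)
  moreover have "b * x ^ ((q ^ s)\<^sup>2) * w * m = - (b * x ^ ((q ^ s)\<^sup>2) * m + x ^ (q ^ s) * m)"
    using assms(4,5) by (simp add: w_def field_simps)
  moreover have "b * x ^ ((q ^ s)\<^sup>2) * (m ^ (q ^ s) - w * m)
      = b * x ^ ((q ^ s)\<^sup>2) * (m ^ (q ^ s) + m)
        - b * x ^ ((q ^ s)\<^sup>2) * m - b * x ^ ((q ^ s)\<^sup>2) * w * m"
    by (simp add: algebra_simps)
  ultimately have "b * x ^ ((q ^ s)\<^sup>2) * (m ^ (q ^ s) - w * m)
      = x ^ (q ^ s) * m + b * x ^ ((q ^ s)\<^sup>2) * (l ^ ((q ^ s)\<^sup>2) - l)"
    by simp
  moreover have "poly f (l * x) - l * poly f x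
      = x ^ (q ^ s) * m + b * x ^ ((q ^ s)\<^sup>2) * (l ^ ((q ^ s)\<^sup>2) - l)"
    by (simp add: f_def m_def poly_monom power_mult_distrib algebra_simps)
  ultimately have "x * (poly f (l * x) - l * poly f x)
      = x * (b * x ^ ((q ^ s)\<^sup>2) * (m ^ (q ^ s) - w * m))"
    by simp
  then show ?thesis by (simp add: algebra_simps)
qed

lemma linearized_binomial: "linearized q (monom 1 (q ^ s) + monom (b::'a) ((q ^ s)\<^sup>2))"
  unfolding linearized_def by (auto simp: power_mult[symmetric] split: if_splits)

text \<open>
  A pair with \<open>x = 0\<close> is dependent and its cross difference vanishes; every other pair has the form
  \<open>(x, l * x)\<close>, so the condition on pairs becomes one on the scalar \<open>l\<close>.
\<close>

lemma scattered_iff_scalar: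
  fixes f :: "'a poly"
  assumes "linearized q f" "poly f 0 = 0"
  shows "scattered q f \<longleftrightarrow>
    (\<forall>x l. x \<noteq> 0 \<longrightarrow> (x * poly f (l * x) - l * x * poly f x = 0 \<longleftrightarrow> l ^ (q ^ s) = l))"
    (is "_ \<longleftrightarrow> ?R")
proof
  assume "scattered q f"
  then show ?R
    by (auto simp: scattered_def lin_dependent_mult_iff power_sigma_eq_self_iff)
next
  note F = Fq_subfield[OF primepow_q n_pos card_field]
  assume R: ?R
  have "x * poly f t - t * poly f x = 0 \<longleftrightarrow> lin_dependent (Fq q) x t" for x t
  proof (cases "x = 0")
    case True
    have "lin_dependent (Fq q) 0 t"
      unfolding lin_dependent_def using F(1,2) by (intro bexI[of _ 1] bexI[of _ 0]) auto
    with True assms(2) show ?thesis by simp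
  next
    case False
    then have t: "t / x * x = t" by simp
    show ?thesis
      using R[rule_format, OF False, of "t / x"] lin_dependent_mult_iff[OF False, of "t / x"]
      unfolding t power_sigma_eq_self_iff by simp
  qed
  with assms(1) show "scattered q f" by (simp add: scattered_def)
qed

end

theorem proposition3p5:
  fixes q n s \<sigma> :: nat and b :: "'a::finite_field"
  assumes "primepow q" and "n \<ge> 3" and "s \<ge> 1" and "gcd s n = 1"
    and "CARD('a) = q ^ n"
    and "\<sigma> = q ^ s"
    and "b \<noteq> 0"
  shows "scattered q (monom 1 \<sigma> + monom b (\<sigma>\<^sup>2)) \<longleftrightarrow>
    \<not> (\<exists>x::'a. x \<noteq> 0 \<and>
        (let w = - (1 + inverse b * x powi (int \<sigma> - int (\<sigma>\<^sup>2)))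
         in (\<Sum>i = 0..n - 1. w ^ ((\<sigma> ^ i - 1) div (\<sigma> - 1))) = 0))"
proof -
  interpret frobenius_generator q n s "TYPE('a)"
    using assms by unfold_locales (auto simp: coprime_iff_gcd_eq_1)
  define f where "f = monom 1 \<sigma> + monom b (\<sigma>\<^sup>2)"
  define w where "w x = - (1 + inverse b * (x ^ \<sigma> / x ^ (\<sigma>\<^sup>2)))" for x
  have "\<sigma> \<ge> 2" using q_power_ge_2 assms(6) by simp
  have powi: "x powi (int \<sigma> - int (\<sigma>\<^sup>2)) = x ^ \<sigma> / x ^ (\<sigma>\<^sup>2)" if "x \<noteq> 0" for x :: 'a
    using power_int_diff[of x "int \<sigma>" "int (\<sigma>\<^sup>2)"] that by (simp only: power_int_of_nat simp_thms)
  have range: "{0..n - 1} = {..<n}" using assms(2) by auto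
  have cross: "x * poly f (l * x) - l * x * poly f x = 0
      \<longleftrightarrow> (l ^ \<sigma> - l) ^ \<sigma> = w x * (l ^ \<sigma> - l)" if "x \<noteq> 0" for x l
    using cross_difference_binomial[OF assms(7) that, of l] assms(7) that
    unfolding f_def w_def assms(6) by simp
  have "scattered q f \<longleftrightarrow> (\<forall>x l. x \<noteq> 0 \<longrightarrow>
      ((l ^ \<sigma> - l) ^ \<sigma> = w x * (l ^ \<sigma> - l) \<longleftrightarrow> l ^ \<sigma> = l))"
  proof (subst scattered_iff_scalar)
    show "linearized q f" unfolding f_def assms(6) by (rule linearized_binomial)
    show "poly f 0 = 0" using \<open>\<sigma> \<ge> 2\<close> by (simp add: f_def poly_monom power_0_left)
  qed (use cross assms(6) in auto)
  also have "\<dots> \<longleftrightarrow> \<not> (\<exists>x. x \<noteq> 0 \<and>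
      (\<exists>l. l ^ \<sigma> - l \<noteq> 0 \<and> (l ^ \<sigma> - l) ^ \<sigma> = w x * (l ^ \<sigma> - l)))"
    using \<open>\<sigma> \<ge> 2\<close> by (auto simp: power_0_left)
  also have "\<dots> \<longleftrightarrow> \<not> (\<exists>x. x \<noteq> 0 \<and> (\<Sum>i<n. w x ^ (\<Sum>j<i. \<sigma> ^ j)) = 0)"
    unfolding assms(6) twisted_fixed_coboundary_iff ..
  also have "\<dots> \<longleftrightarrow> \<not> (\<exists>x. x \<noteq> 0 \<and>
      (let w = - (1 + inverse b * x powi (int \<sigma> - int (\<sigma>\<^sup>2)))
       in (\<Sum>i = 0..n - 1. w ^ ((\<sigma> ^ i - 1) div (\<sigma> - 1))) = 0))"
    unfolding geometric_quotient_eq_sum[OF \<open>\<sigma> \<ge> 2\<close>] range Let_def w_def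
    by (simp only: powi simp_thms cong: conj_cong)
  finally show ?thesis unfolding f_def .
qed

end
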